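(* Let $G$ be a finite permutation group acting transitively on the set $\Omega$. Let $\alpha\in\Omega$ and let $\Delta=\bigcup_{i=1}^{s}G_\alpha.\delta_i$ be a union of orbits of the stabilizer $G_\alpha$ of $\alpha$, where $\delta_1,\dots,\delta_s\in\Omega$ are representatives of distinct $G_\alpha$-orbits. Let $T=\{g_1,\dots,g_t\}$ be a set of representatives of the left cosets in $G/G_\alpha=\{g_1G_\alpha,\dots,g_tG_\alpha\}$. Let $$\mathcal{V}=\{g_i.\alpha \mid i=1,\dots,t\},\qquad \mathcal{A}=\{(g_i.\alpha,g_i.\beta)\mid i=1,\dots,t,\ \beta\in\Delta\}.$$ Then $\mathcal{G}=(\mathcal{V},\mathcal{A})$ is a directed graph on $|\Omega|$ vertices that is $|\Delta|$-regular and such that, for each $i=1,\dots,t$, $g_i.\Delta$ is the set of out-neighbors of the vertex $g_i.\alpha$.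
   Context: The image of $x\in\Omega$ under $g\in G$ is written $g.x$; for a subset $\Delta\subseteq\Omega$, $g.\Delta=\{g.x\mid x\in\Delta\}$, and $G_\alpha.\delta=\{g.\delta\mid g\in G_\alpha\}$. A directed graph $(\mathcal{V},\mathcal{A})$ consists of a non-empty finite vertex set $\mathcal{V}$ and a set $\mathcal{A}$ of ordered pairs of vertices (arcs). If $(x,y)\in\mathcal{A}$, then $y$ is an out-neighbor of $x$ and $x$ is an in-neighbor of $y$. A directed graph is $k$-regular if every vertex has exactly $k$ in-neighbors and exactly $k$ out-neighbors. If the diagonal orbit $\{\alpha\}$ is included in $\Delta$, the resulting digraph has a loop at every vertex, and then each vertex is counted as an in- and out-neighbor of itself. *)

theory Defs
  imports
    "HOL-Algebra.Group_Action"
    "HOL-Algebra.Left_Coset"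
    "Graph_Theory.Pair_Digraph"
begin

text \<open>
  The locale \<^locale>\<open>pair_fin_digraph\<close> admits loops and the null graph; a directed graph here
  must have at least one vertex.
\<close>

definition directed_graph :: "'v pair_pre_digraph \<Rightarrow> bool" where
  "directed_graph D \<longleftrightarrow> pair_fin_digraph D \<and> pverts D \<noteq> {}"

definition out_neighbors :: "'v pair_pre_digraph \<Rightarrow> 'v \<Rightarrow> 'v set" where
  "out_neighbors D x = {y. (x, y) \<in> parcs D}"

definition in_neighbors :: "'v pair_pre_digraph \<Rightarrow> 'v \<Rightarrow> 'v set" where
  "in_neighbors D y = {x. (x, y) \<in> parcs D}"

text \<open>A vertex with a loop is counted among its own in- and out-neighbors.\<close>

definition k_regular :: "nat \<Rightarrow> 'v pair_pre_digraph \<Rightarrow> bool" where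
  "k_regular k D \<longleftrightarrow>
    (\<forall>v \<in> pverts D. card (in_neighbors D v) = k \<and> card (out_neighbors D v) = k)"

text \<open>
  For an action \<open>\<phi>\<close> of \<open>G\<close>, the orbit of \<open>x\<close> under the stabilizer of \<open>\<alpha>\<close>, i.e. under the
  restriction of \<open>\<phi>\<close> to the subgroup \<open>stabilizer G \<phi> \<alpha>\<close>.
\<close>

definition stab_orbit :: "('a, 'c) monoid_scheme \<Rightarrow> ('a \<Rightarrow> 'b \<Rightarrow> 'b) \<Rightarrow> 'b \<Rightarrow> 'b \<Rightarrow> 'b set" where
  "stab_orbit G \<phi> \<alpha> x = orbit (G\<lparr>carrier := stabilizer G \<phi> \<alpha>\<rparr>) \<phi> x"

end

theory Submission
  imports Defs
begin

text \<open>
  The key point is that the arc set does not depend on the chosen coset representatives: it is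
  the set of all pairs \<open>(g.\<alpha>, g.\<beta>)\<close> with \<open>g\<close> in the whole group and \<open>\<beta> \<in> \<Delta>\<close>. Indeed, writing
  \<open>g = g\<^sub>i k\<close> with \<open>k\<close> in the stabilizer gives \<open>g.\<alpha> = g\<^sub>i.\<alpha>\<close> and \<open>g.\<beta> = g\<^sub>i.(k.\<beta>)\<close>, and \<open>k.\<beta>\<close> is
  again in \<open>\<Delta>\<close> because \<open>\<Delta>\<close> is a union of orbits of the stabilizer
  (\<open>arcs_from_coset_representatives\<close>). For the same reason \<open>g.\<Delta>\<close> depends only on the point
  \<open>g.\<alpha>\<close>, so that the out-neighbors of \<open>g.\<alpha>\<close> are exactly \<open>g.\<Delta>\<close> (\<open>out_neighbors_translate\<close>), which is a set of size \<open>|\<Delta>|\<close> because \<open>g\<close>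
  acts injectively.

  In this form the arc set is visibly invariant under the group, which acts transitively on the
  vertices. Hence all in-degrees agree, all out-degrees agree, and counting the arcs once by tails
  and once by heads shows that the two common values coincide
  (\<open>invariant_relation_regular\<close>).
\<close>

section \<open>Orbits of the stabilizer\<close>

lemma (in group_action) stab_orbit_subset:
  assumes "x \<in> E"
  shows "stab_orbit G \<phi> \<alpha> x \<subseteq> E"
  using assms element_image by (auto simp: stab_orbit_def orbit_def stabilizer_def)

lemma (in group_action) stab_orbit_closed:
  assumes "\<alpha> \<in> E" "x \<in> E" "k \<in> stabilizer G \<phi> \<alpha>" "y \<in> stab_orbit G \<phi> \<alpha> x"
  shows "\<phi> k y \<in> stab_orbit G \<phi> \<alpha> x"
proof -
  obtain h where h: "h \<in> stabilizer G \<phi> \<alpha>" "y = \<phi> h x"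
    using assms(4) by (auto simp: stab_orbit_def orbit_def)
  have "\<phi> k y = \<phi> (k \<otimes> h) x"
    using composition_rule[OF assms(2)] h assms(3) stabilizer_subset by (metis subsetD)
  moreover have "k \<otimes> h \<in> stabilizer G \<phi> \<alpha>"
    using stabilizer_m_closed assms(1,3) h(1) by blast
  ultimately show ?thesis
    by (auto simp: stab_orbit_def orbit_def)
qed

section \<open>Translates of a set stable under the stabilizer\<close>

text \<open>
  Translates of \<open>\<Delta>\<close> are indexed by points: two elements that carry \<open>\<alpha>\<close> to the same point differ
  by an element of the stabilizer, which \<open>\<Delta>\<close> absorbs. The inclusion suffices, as the two elements
  play symmetric roles.
\<close>

lemma (in group_action) translate_subset_of_same_point:
  assumes "\<alpha> \<in> E" "\<Delta> \<subseteq> E"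
    and stable: "\<And>k \<beta>. k \<in> stabilizer G \<phi> \<alpha> \<Longrightarrow> \<beta> \<in> \<Delta> \<Longrightarrow> \<phi> k \<beta> \<in> \<Delta>"
    and g: "g \<in> carrier G" and h: "h \<in> carrier G" and same: "\<phi> g \<alpha> = \<phi> h \<alpha>"
  shows "\<phi> h ` \<Delta> \<subseteq> \<phi> g ` \<Delta>"
proof
  interpret group G
    using group_hom group_hom.axioms(1) by auto
  fix y assume "y \<in> \<phi> h ` \<Delta>"
  then obtain \<beta> where \<beta>: "\<beta> \<in> \<Delta>" "y = \<phi> h \<beta>" by blast
  define k where "k = inv g \<otimes> h"
  have k: "k \<in> carrier G" "h = g \<otimes> k"
    using g h by (simp_all add: k_def m_assoc[symmetric])
  have "\<phi> k \<alpha> = \<phi> (inv g) (\<phi> h \<alpha>)"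
    using composition_rule assms(1) g h by (simp add: k_def)
  also have "\<dots> = \<alpha>"
    using orbit_sym_aux[OF g assms(1) same] .
  finally have "k \<in> stabilizer G \<phi> \<alpha>"
    using k(1) by (simp add: stabilizer_def)
  then have "\<phi> k \<beta> \<in> \<Delta>"
    using stable \<beta>(1) by blast
  moreover have "y = \<phi> g (\<phi> k \<beta>)"
    using composition_rule \<beta> assms(2) g k by auto
  ultimately show "y \<in> \<phi> g ` \<Delta>" by blast
qed

lemma (in group_action) out_neighbors_translate:
  assumes "\<alpha> \<in> E" "\<Delta> \<subseteq> E"
    and stable: "\<And>k \<beta>. k \<in> stabilizer G \<phi> \<alpha> \<Longrightarrow> \<beta> \<in> \<Delta> \<Longrightarrow> \<phi> k \<beta> \<in> \<Delta>"
    and g: "g \<in> carrier G"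
  shows "{y. (\<phi> g \<alpha>, y) \<in> {(\<phi> h \<alpha>, \<phi> h \<beta>) | h \<beta>. h \<in> carrier G \<and> \<beta> \<in> \<Delta>}} = \<phi> g ` \<Delta>"
  using translate_subset_of_same_point[OF assms(1,2) stable g] g by auto

section \<open>Coset representatives\<close>

lemma (in group_action) coset_representative_factorization:
  assumes "\<alpha> \<in> E" "R \<subseteq> carrier G"
    and cover: "lcosets (stabilizer G \<phi> \<alpha>) \<subseteq> (\<lambda>r. r <# stabilizer G \<phi> \<alpha>) ` R"
    and h: "h \<in> carrier G"
  obtains r k where "r \<in> R" "k \<in> stabilizer G \<phi> \<alpha>" "h = r \<otimes> k"
proof -
  interpret group G
    using group_hom group_hom.axioms(1) by auto
  have "h <# stabilizer G \<phi> \<alpha> \<in> lcosets (stabilizer G \<phi> \<alpha>)"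
    using h by (auto simp: LCOSETS_def)
  then obtain r where "r \<in> R" "h <# stabilizer G \<phi> \<alpha> = r <# stabilizer G \<phi> \<alpha>"
    using cover by blast
  then show thesis
    using that lcos_self[OF h stabilizer_subgroup[OF assms(1)]] by (auto simp: l_coset_def)
qed

text \<open>
  As \<open>\<Delta>\<close> absorbs the stabilizer, letting the translating element range over the whole group
  adds no arcs to those obtained from the coset representatives.
  The second description is the one that is invariant under the action.
\<close>

lemma (in group_action) arcs_from_coset_representatives:
  assumes "\<alpha> \<in> E" "\<Delta> \<subseteq> E"
    and stable: "\<And>k \<beta>. k \<in> stabilizer G \<phi> \<alpha> \<Longrightarrow> \<beta> \<in> \<Delta> \<Longrightarrow> \<phi> k \<beta> \<in> \<Delta>"
    and R: "R \<subseteq> carrier G"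
    and cover: "lcosets (stabilizer G \<phi> \<alpha>) \<subseteq> (\<lambda>r. r <# stabilizer G \<phi> \<alpha>) ` R"
  shows "{(\<phi> r \<alpha>, \<phi> r \<beta>) | r \<beta>. r \<in> R \<and> \<beta> \<in> \<Delta>}
    = {(\<phi> h \<alpha>, \<phi> h \<beta>) | h \<beta>. h \<in> carrier G \<and> \<beta> \<in> \<Delta>}" (is "?L = ?R")
proof
  show "?L \<subseteq> ?R" using R by blast
  show "?R \<subseteq> ?L"
  proof clarify
    fix h \<beta> assume h: "h \<in> carrier G" and \<beta>: "\<beta> \<in> \<Delta>"
    obtain r k where rk: "r \<in> R" "k \<in> stabilizer G \<phi> \<alpha>" "h = r \<otimes> k"
      using coset_representative_factorization[OF assms(1) R cover h] .
    have k: "k \<in> carrier G" "\<phi> k \<alpha> = \<alpha>"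
      using rk(2) by (auto simp: stabilizer_def)
    have "r \<in> carrier G" "\<beta> \<in> E"
      using rk(1) R \<beta> assms(2) by auto
    then have "\<phi> h \<alpha> = \<phi> r \<alpha>" "\<phi> h \<beta> = \<phi> r (\<phi> k \<beta>)"
      using composition_rule rk(3) k assms(1) by simp_all
    then show "\<exists>r \<beta>'. (\<phi> h \<alpha>, \<phi> h \<beta>) = (\<phi> r \<alpha>, \<phi> r \<beta>') \<and> r \<in> R \<and> \<beta>' \<in> \<Delta>"
      using rk(1) stable[OF rk(2) \<beta>] by auto
  qed
qed

lemma (in transitive_action) coset_representatives_reach_all_points:
  assumes "\<alpha> \<in> E" and R: "R \<subseteq> carrier G"
    and cover: "lcosets (stabilizer G \<phi> \<alpha>) \<subseteq> (\<lambda>r. r <# stabilizer G \<phi> \<alpha>) ` R"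
  shows "(\<lambda>r. \<phi> r \<alpha>) ` R = E"
proof
  show "(\<lambda>r. \<phi> r \<alpha>) ` R \<subseteq> E" using element_image assms(1) R by blast
  show "E \<subseteq> (\<lambda>r. \<phi> r \<alpha>) ` R"
  proof
    fix x assume "x \<in> E"
    then obtain h where h: "h \<in> carrier G" "\<phi> h \<alpha> = x"
      using unique_orbit assms(1) by blast
    obtain r k where rk: "r \<in> R" "k \<in> stabilizer G \<phi> \<alpha>" "h = r \<otimes> k"
      using coset_representative_factorization[OF assms(1) R cover h(1)] .
    then have "x = \<phi> r \<alpha>"
      using composition_rule[OF assms(1)] R h(2) by (auto simp: stabilizer_def)
    then show "x \<in> (\<lambda>r. \<phi> r \<alpha>) ` R" using rk(1) by blast
  qed
qed

section \<open>Regularity of invariant relations\<close>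

text \<open>
  A group element that carries \<open>u\<close> to \<open>v\<close> embeds the successors of \<open>u\<close> into those of \<open>v\<close>, so
  the degree at \<open>u\<close> is at most the degree at \<open>v\<close>. By transitivity this holds for all pairs of
  points, in both directions.
\<close>

lemma (in transitive_action) invariant_relation_constant_degree:
  assumes "finite E" and A: "A \<subseteq> E \<times> E"
    and inv: "\<And>g x y. g \<in> carrier G \<Longrightarrow> (x, y) \<in> A \<Longrightarrow> (\<phi> g x, \<phi> g y) \<in> A"
    and "x \<in> E" "x' \<in> E"
  shows "card {y. (x, y) \<in> A} = card {y. (x', y) \<in> A}"
proof -
  have le: "card {y. (u, y) \<in> A} \<le> card {y. (v, y) \<in> A}" if uv: "u \<in> E" "v \<in> E" for u v
  proof -
    obtain g where g: "g \<in> carrier G" "\<phi> g u = v"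
      using unique_orbit uv by blast
    show ?thesis
    proof (rule card_inj_on_le)
      show "inj_on (\<phi> g) {y. (u, y) \<in> A}"
        using inj_prop[OF g(1)] A by (auto intro: inj_on_subset)
      show "\<phi> g ` {y. (u, y) \<in> A} \<subseteq> {y. (v, y) \<in> A}"
        using inv[OF g(1)] g(2) by auto
      show "finite {y. (v, y) \<in> A}"
        using A assms(1) by (auto intro: finite_subset)
    qed
  qed
  show ?thesis using le assms(4,5) by (simp add: le_antisym)
qed

text \<open>
  The in-degrees of a relation are the out-degrees of its converse, so both are constant. Their
  common values agree because each of them, multiplied by the number of points, counts the
  relation.
\<close>

lemma (in transitive_action) invariant_relation_regular:
  assumes fin: "finite E" and A: "A \<subseteq> E \<times> E"
    and inv: "\<And>g x y. g \<in> carrier G \<Longrightarrow> (x, y) \<in> A \<Longrightarrow> (\<phi> g x, \<phi> g y) \<in> A"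
    and x: "x \<in> E" and y: "y \<in> E"
  shows "card {u. (u, y) \<in> A} = card {v. (x, v) \<in> A}"
proof -
  have out: "card {v. (u, v) \<in> A} = card {v. (x, v) \<in> A}" if "u \<in> E" for u
    using invariant_relation_constant_degree[OF fin A inv that x] .
  have in_deg: "card {u. (u, v) \<in> A} = card {u. (u, y) \<in> A}" if "v \<in> E" for v
    using invariant_relation_constant_degree[of "A\<inverse>", OF fin _ _ that y] A inv by auto
  have pred: "{u \<in> E. (u, v) \<in> A} = {u. (u, v) \<in> A}"
    and succ: "{w \<in> E. (v, w) \<in> A} = {w. (v, w) \<in> A}" for v
    using A by auto
  have "card E * card {u. (u, y) \<in> A} = (\<Sum>v\<in>E. card {u \<in> E. (u, v) \<in> A})"
    using in_deg pred by simp
  also have "\<dots> = (\<Sum>u\<in>E. card {v \<in> E. (u, v) \<in> A})"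
    using sum_multicount_gen[OF fin fin, of "\<lambda>v u. (u, v) \<in> A"] by simp
  also have "\<dots> = card E * card {v. (x, v) \<in> A}"
    using out succ by simp
  finally show ?thesis
    using fin x by auto
qed

section \<open>The digraph of a union of suborbits\<close>

theorem theorem3p1:
  fixes G :: "('a, 'c) monoid_scheme"
    and \<Omega> :: "'b set"
    and \<phi> :: "'a \<Rightarrow> 'b \<Rightarrow> 'b"
    and \<alpha> :: 'b
    and s t :: nat
    and \<delta> :: "nat \<Rightarrow> 'b"
    and g :: "nat \<Rightarrow> 'a"
    and \<Delta> \<V> :: "'b set"
    and \<A> :: "('b \<times> 'b) set"
    and \<G> :: "'b pair_pre_digraph"
  assumes finite_G: "finite (carrier G)"
    and permutation_group: "faithful_action G \<Omega> \<phi>"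
    and transitive: "transitive_action G \<Omega> \<phi>"
    and alpha: "\<alpha> \<in> \<Omega>"
    and delta: "\<And>i. i \<in> {1..s} \<Longrightarrow> \<delta> i \<in> \<Omega>"
    and distinct_orbits: "inj_on (\<lambda>i. stab_orbit G \<phi> \<alpha> (\<delta> i)) {1..s}"
    and Delta: "\<Delta> = (\<Union>i\<in>{1..s}. stab_orbit G \<phi> \<alpha> (\<delta> i))"
    and g_in_G: "\<And>i. i \<in> {1..t} \<Longrightarrow> g i \<in> carrier G"
    and coset_representatives:
      "bij_betw (\<lambda>i. g i <#\<^bsub>G\<^esub> stabilizer G \<phi> \<alpha>) {1..t} (lcosets\<^bsub>G\<^esub> (stabilizer G \<phi> \<alpha>))"
    and V: "\<V> = {\<phi> (g i) \<alpha> | i. i \<in> {1..t}}"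
    and A: "\<A> = {(\<phi> (g i) \<alpha>, \<phi> (g i) \<beta>) | i \<beta>. i \<in> {1..t} \<and> \<beta> \<in> \<Delta>}"
    and digraph: "\<G> = \<lparr>pverts = \<V>, parcs = \<A>\<rparr>"
  shows "directed_graph \<G>
    \<and> card (pverts \<G>) = card \<Omega>
    \<and> k_regular (card \<Delta>) \<G>
    \<and> (\<forall>i\<in>{1..t}. out_neighbors \<G> (\<phi> (g i) \<alpha>) = \<phi> (g i) ` \<Delta>)"
proof -
  interpret transitive_action G \<Omega> \<phi> by (rule transitive)
  let ?R = "g ` {1..t}"
  have R: "?R \<subseteq> carrier G" using g_in_G by blast
  have cover: "lcosets\<^bsub>G\<^esub> (stabilizer G \<phi> \<alpha>) \<subseteq> (\<lambda>r. r <#\<^bsub>G\<^esub> stabilizer G \<phi> \<alpha>) ` ?R"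
    using bij_betw_imp_surj_on[OF coset_representatives] by (simp add: image_image)
  have \<Delta>_sub: "\<Delta> \<subseteq> \<Omega>"
    unfolding Delta using stab_orbit_subset delta by blast
  have stable: "\<phi> k \<beta> \<in> \<Delta>" if "k \<in> stabilizer G \<phi> \<alpha>" "\<beta> \<in> \<Delta>" for k \<beta>
    using that stab_orbit_closed[OF alpha delta] unfolding Delta by blast
  have V_eq: "\<V> = \<Omega>"
    using coset_representatives_reach_all_points[OF alpha R cover] unfolding V by auto
  have A_eq: "\<A> = {(\<phi> h \<alpha>, \<phi> h \<beta>) | h \<beta>. h \<in> carrier G \<and> \<beta> \<in> \<Delta>}"
  proof -
    have "\<A> = {(\<phi> r \<alpha>, \<phi> r \<beta>) | r \<beta>. r \<in> ?R \<and> \<beta> \<in> \<Delta>}"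
      unfolding A by blast
    then show ?thesis
      using arcs_from_coset_representatives[OF alpha \<Delta>_sub stable R cover] by simp
  qed
  have out: "{y. (\<phi> h \<alpha>, y) \<in> \<A>} = \<phi> h ` \<Delta>" if "h \<in> carrier G" for h
    unfolding A_eq using out_neighbors_translate[OF alpha \<Delta>_sub stable that] .
  have A_sub: "\<A> \<subseteq> \<Omega> \<times> \<Omega>"
    using A_eq element_image alpha \<Delta>_sub by blast
  have A_inv: "(\<phi> h x, \<phi> h y) \<in> \<A>" if h: "h \<in> carrier G" and xy: "(x, y) \<in> \<A>" for h x y
  proof -
    interpret group G
      using group_hom group_hom.axioms(1) by auto
    obtain h' \<beta> where h': "h' \<in> carrier G" "\<beta> \<in> \<Delta>" "x = \<phi> h' \<alpha>" "y = \<phi> h' \<beta>"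
      using xy unfolding A_eq by blast
    then have "\<phi> h x = \<phi> (h \<otimes>\<^bsub>G\<^esub> h') \<alpha>" "\<phi> h y = \<phi> (h \<otimes>\<^bsub>G\<^esub> h') \<beta>"
      using composition_rule h alpha \<Delta>_sub by auto
    then show ?thesis
      unfolding A_eq using h h' by blast
  qed
  have fin: "finite \<Omega>"
    using V_eq unfolding V by auto
  have out_card: "card {y. (x, y) \<in> \<A>} = card \<Delta>" if x: "x \<in> \<Omega>" for x
  proof -
    obtain h where h: "h \<in> carrier G" "\<phi> h \<alpha> = x"
      using unique_orbit alpha x by blast
    then show ?thesis
      using out[OF h(1)] card_image[OF inj_on_subset[OF inj_prop \<Delta>_sub]] by simp
  qed
  have in_card: "card {u. (u, y) \<in> \<A>} = card \<Delta>" if "y \<in> \<Omega>" for y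
    using invariant_relation_regular[OF fin A_sub A_inv that that] out_card[OF that] by simp
  have "pair_fin_digraph \<G>"
    using A_sub fin finite_subset[OF A_sub]
    by unfold_locales (auto simp: digraph V_eq)
  then have "directed_graph \<G>"
    using alpha by (auto simp: directed_graph_def digraph V_eq)
  moreover have "k_regular (card \<Delta>) \<G>"
    using in_card out_card
    by (simp add: k_regular_def in_neighbors_def out_neighbors_def digraph V_eq)
  moreover have "\<forall>i\<in>{1..t}. out_neighbors \<G> (\<phi> (g i) \<alpha>) = \<phi> (g i) ` \<Delta>"
    using out g_in_G by (simp add: out_neighbors_def digraph)
  ultimately show ?thesis
    by (simp add: digraph V_eq)
qed

end
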